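(* Let $X$ be an oriented graph with vertices $a$ and $b$. There is perfect state transfer from $a$ to $b$ if and only if: (i) $a$ and $b$ are strongly cospectral; and (ii) there exists $\tau\in\mathbb{R}$ such that the numbers $q_r(a,b)+\frac{i\tau\theta_r}{\pi}$, for $\theta_r\in\Phi_a$, are either all even integers or all odd integers.
   Context: An oriented graph $X$ is a simple undirected graph in which every edge is given one of its two directions. Its adjacency matrix $A$ is indexed by $V(X)$, with $A_{a,b}=1$ if the edge $\{a,b\}$ is oriented from $a$ to $b$, $A_{a,b}=-1$ if it is oriented from $b$ to $a$, and $0$ if $a,b$ are non-adjacent. The transition matrix is $U(t)=\exp(tA)$, and $e_a$ is the standard basis vector of vertex $a$. There is perfect state transfer from $a$ to $b$ if $U(\tau)e_a=\lambda e_b$ for some $\tau\in\mathbb{R}$ and $\lambda\in\mathbb{C}$ with $|\lambda|=1$. Let $\theta_0,\ldots,\theta_d$ be the distinct (complex, purely imaginary) eigenvalues of $A$ and $E_r$ the orthogonal projection of $\mathbb{C}^{V(X)}$ onto the $\theta_r$-eigenspace. The eigenvalue support of $a$ is $\Phi_a=\{\theta_r: E_re_a\neq 0\}$. Vertices $a$ and $b$ are strongly cospectral if for each $r$ with $\theta_r\in\Phi_a$ there is $\alpha_r\in\mathbb{C}$ with $|\alpha_r|=1$ and $E_re_a=\alpha_rE_re_b$; in that case the quarrel $q_r(a,b)$ is a real number with $-1\le q_r(a,b)\le1$ such that $E_re_a=e^{i\pi q_r(a,b)}E_re_b$. *)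

theory Defs
  imports "HOL-Analysis.Analysis"
begin

text \<open>The vertex set is a finite type; an oriented graph on it is given by its set of arcs,
  \<open>(a, b) \<in> X\<close> meaning that the edge \<open>{a, b}\<close> is present and directed from \<open>a\<close> to \<open>b\<close>.\<close>

definition oriented_graph :: "('v::finite \<times> 'v) set \<Rightarrow> bool" where
  "oriented_graph X \<longleftrightarrow> (\<forall>a. (a, a) \<notin> X) \<and> (\<forall>a b. (a, b) \<in> X \<longrightarrow> (b, a) \<notin> X)"

definition adj_matrix :: "('v::finite \<times> 'v) set \<Rightarrow> complex^'v^'v" where
  "adj_matrix X = (\<chi> a b. if (a, b) \<in> X then 1 else if (b, a) \<in> X then -1 else 0)"

text \<open>The type \<open>complex^'n^'n\<close> carries componentwise multiplication, hence neither the library's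
  power nor its \<open>exp\<close> is the matrix one.\<close>

definition matrix_pow :: "complex^'n^'n \<Rightarrow> nat \<Rightarrow> complex^'n^'n" where
  "matrix_pow A k = (((**) A) ^^ k) (mat 1)"

definition matrix_exp :: "complex^'n^'n \<Rightarrow> complex^'n^'n" where
  "matrix_exp A = (\<Sum>k. (1 / fact k) *\<^sub>R matrix_pow A k)"

lemma summable_matrix_exp:
  fixes A :: "complex^'n^'n"
  shows "summable (\<lambda>k. (1 / fact k) *\<^sub>R matrix_pow A k)"
proof -
  have "linear (\<lambda>B::complex^'n^'n. A ** B)"
    by (rule linearI)
      (simp_all add: matrix_matrix_mult_def vec_eq_iff scaleR_sum_right distrib_left sum.distrib)
  then obtain K where K: "K > 0" "\<And>B::complex^'n^'n. norm (A ** B) \<le> K * norm B"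
    using linear_bounded_pos by blast
  have bound: "norm (matrix_pow A k) \<le> K ^ k * norm (mat 1 :: complex^'n^'n)" for k
  proof (induction k)
    case 0
    show ?case by (simp add: matrix_pow_def)
  next
    case (Suc k)
    have "norm (matrix_pow A (Suc k)) \<le> K * norm (matrix_pow A k)"
      using K(2) by (simp add: matrix_pow_def)
    also have "\<dots> \<le> K * (K ^ k * norm (mat 1 :: complex^'n^'n))"
      using Suc K(1) by (simp add: mult_left_mono)
    finally show ?case by (simp add: mult.assoc)
  qed
  have "summable (\<lambda>k. (inverse (fact k) * K ^ k) * norm (mat 1 :: complex^'n^'n))"
    by (intro summable_mult2 summable_exp)
  then show ?thesis
  proof (rule summable_comparison_test'[where N = 0])
    fix k :: nat
    show "norm ((1 / fact k) *\<^sub>R matrix_pow A k)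
        \<le> inverse (fact k) * K ^ k * norm (mat 1 :: complex^'n^'n)"
      using mult_left_mono[OF bound[of k], of "inverse (fact k)"]
      by (simp add: divide_inverse mult.assoc)
  qed
qed

definition transition_matrix :: "('v::finite \<times> 'v) set \<Rightarrow> real \<Rightarrow> complex^'v^'v" where
  "transition_matrix X t = matrix_exp (t *\<^sub>R adj_matrix X)"

definition perfect_state_transfer :: "('v::finite \<times> 'v) set \<Rightarrow> 'v \<Rightarrow> 'v \<Rightarrow> bool" where
  "perfect_state_transfer X a b \<longleftrightarrow>
     (\<exists>(\<tau>::real) (z::complex). norm z = 1 \<and> transition_matrix X \<tau> *v axis a 1 = z *s axis b 1)"

definition eigenspace :: "complex^'n^'n \<Rightarrow> complex \<Rightarrow> (complex^'n) set" where
  "eigenspace A \<theta> = {v. A *v v = \<theta> *s v}"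

definition is_eigenvalue :: "complex^'n^'n \<Rightarrow> complex \<Rightarrow> bool" where
  "is_eigenvalue A \<theta> \<longleftrightarrow> (\<exists>v. v \<noteq> 0 \<and> v \<in> eigenspace A \<theta>)"

text \<open>The library's inner product on \<open>complex^'n\<close> is the real part of the Hermitian one.\<close>

definition hinner :: "complex^'n \<Rightarrow> complex^'n \<Rightarrow> complex" where
  "hinner u v = (\<Sum>i\<in>UNIV. cnj (u $ i) * v $ i)"

definition orth_proj :: "(complex^'n) set \<Rightarrow> complex^'n \<Rightarrow> complex^'n" where
  "orth_proj S v = (THE w. w \<in> S \<and> (\<forall>u\<in>S. hinner u (v - w) = 0))"

lemma Re_hinner: "Re (hinner u v) = u \<bullet> v"
  by (simp add: hinner_def inner_vec_def inner_complex_def)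

lemma hinner_scale_left: "hinner (c *s u) v = cnj c * hinner u v"
  by (simp add: hinner_def sum_distrib_left mult.assoc)

lemma orth_proj_ex1:
  fixes S :: "(complex^'n) set"
  assumes sub: "subspace S" and scale: "\<And>c u. u \<in> S \<Longrightarrow> c *s u \<in> S"
  shows "\<exists>!w. w \<in> S \<and> (\<forall>u\<in>S. hinner u (v - w) = 0)"
proof -
  have span: "span S = S"
    using sub by (simp add: span_eq_iff)
  obtain y z where y: "y \<in> S" and z: "\<And>w. w \<in> S \<Longrightarrow> orthogonal z w" and v: "v = y + z"
    using orthogonal_subspace_decomp_exists[of S v] unfolding span by blast
  have h0: "hinner u z = 0" if "u \<in> S" for u
  proof -
    have r: "Re (hinner u' z) = 0" if "u' \<in> S" for u'
      using z[OF that] by (simp add: Re_hinner orthogonal_def inner_commute)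
    have "Re (cnj \<i> * hinner u z) = 0"
      using r[OF scale[OF that, of "\<i>"]] unfolding hinner_scale_left .
    with r[OF that] show ?thesis
      by (simp add: complex_eq_iff)
  qed
  show ?thesis
  proof (rule ex1I[of _ y])
    show "y \<in> S \<and> (\<forall>u\<in>S. hinner u (v - y) = 0)"
      using y h0 v by simp
  next
    fix w assume w: "w \<in> S \<and> (\<forall>u\<in>S. hinner u (v - w) = 0)"
    have d: "w - y \<in> S"
      using w y sub by (simp add: subspace_diff)
    have "(w - y) \<bullet> (v - w) = 0" "(w - y) \<bullet> z = 0"
      using w d h0[OF d] by (simp_all flip: Re_hinner)
    then have "(w - y) \<bullet> (w - y) = 0"
      unfolding v by (simp add: inner_diff_right inner_add_right)
    then show "w = y" by simp
  qed
qed

lemma subspace_eigenspace: "subspace (eigenspace A \<theta>)"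
proof (rule subspaceI)
  show "0 \<in> eigenspace A \<theta>"
    by (simp add: eigenspace_def matrix_vector_mult_0_right vec_eq_iff)
  show "x + y \<in> eigenspace A \<theta>" if "x \<in> eigenspace A \<theta>" "y \<in> eigenspace A \<theta>" for x y
    using that by (simp add: eigenspace_def matrix_vector_right_distrib vector_add_ldistrib)
  show "c *\<^sub>R x \<in> eigenspace A \<theta>" if "x \<in> eigenspace A \<theta>" for c x
  proof -
    have "A *v (c *\<^sub>R x) = c *\<^sub>R (A *v x)"
      by (simp add: matrix_vector_mult_def vec_eq_iff scaleR_sum_right)
    then show ?thesis
      using that by (simp add: eigenspace_def vec_eq_iff)
  qed
qed

lemma eigenspace_scale: "u \<in> eigenspace A \<theta> \<Longrightarrow> c *s u \<in> eigenspace A \<theta>"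
  by (simp add: eigenspace_def vector_scalar_commute vec_eq_iff mult.left_commute)

text \<open>Spectral data are indexed by the eigenvalue \<open>\<theta>\<close> itself instead of by a number \<open>r\<close> with
  \<open>\<theta> = \<theta>\<^sub>r\<close>; \<open>eig_proj X \<theta>\<close> is \<open>E\<^sub>r\<close>.\<close>

definition eig_proj :: "('v::finite \<times> 'v) set \<Rightarrow> complex \<Rightarrow> complex^'v \<Rightarrow> complex^'v" where
  "eig_proj X \<theta> = orth_proj (eigenspace (adj_matrix X) \<theta>)"

lemma eig_proj_props:
  "eig_proj X \<theta> v \<in> eigenspace (adj_matrix X) \<theta>"
  "u \<in> eigenspace (adj_matrix X) \<theta> \<Longrightarrow> hinner u (v - eig_proj X \<theta> v) = 0"
  using theI'[OF orth_proj_ex1[OF subspace_eigenspace[of "adj_matrix X" \<theta>] eigenspace_scale, of v]]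
  by (auto simp: eig_proj_def orth_proj_def)

definition eig_support :: "('v::finite \<times> 'v) set \<Rightarrow> 'v \<Rightarrow> complex set" where
  "eig_support X a = {\<theta>. is_eigenvalue (adj_matrix X) \<theta> \<and> eig_proj X \<theta> (axis a 1) \<noteq> 0}"

definition strongly_cospectral :: "('v::finite \<times> 'v) set \<Rightarrow> 'v \<Rightarrow> 'v \<Rightarrow> bool" where
  "strongly_cospectral X a b \<longleftrightarrow>
     (\<forall>\<theta>\<in>eig_support X a. \<exists>\<alpha>::complex. norm \<alpha> = 1 \<and>
        eig_proj X \<theta> (axis a 1) = \<alpha> *s eig_proj X \<theta> (axis b 1))"

text \<open>A predicate rather than a function: when the phase is \<open>-1\<close>, both \<open>1\<close> and \<open>-1\<close> are
  admissible values of the quarrel.\<close>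

definition is_quarrel :: "('v::finite \<times> 'v) set \<Rightarrow> 'v \<Rightarrow> 'v \<Rightarrow> complex \<Rightarrow> real \<Rightarrow> bool" where
  "is_quarrel X a b \<theta> q \<longleftrightarrow> -1 \<le> q \<and> q \<le> 1 \<and>
     eig_proj X \<theta> (axis a 1) = exp (\<i> * of_real (pi * q)) *s eig_proj X \<theta> (axis b 1)"

lemma quarrel_exists:
  assumes "strongly_cospectral X a b" "\<theta> \<in> eig_support X a"
  shows "\<exists>q. is_quarrel X a b \<theta> q"
proof -
  obtain \<alpha> :: complex where \<alpha>: "norm \<alpha> = 1"
    "eig_proj X \<theta> (axis a 1) = \<alpha> *s eig_proj X \<theta> (axis b 1)"
    using assms by (auto simp: strongly_cospectral_def)
  have "\<alpha> = exp (\<i> * of_real (pi * (Arg \<alpha> / pi)))"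
    using \<alpha>(1) Arg_eq[of \<alpha>] by force
  moreover have "-1 \<le> Arg \<alpha> / pi" "Arg \<alpha> / pi \<le> 1"
    using mpi_less_Arg[of \<alpha>] Arg_le_pi[of \<alpha>] by (simp_all add: field_simps)
  ultimately show ?thesis
    using \<alpha>(2) unfolding is_quarrel_def by metis
qed

end

theory Submission
  imports Defs
begin

text \<open>The matrix \<open>A\<close> is skew-Hermitian, so its eigenvalues are imaginary, its eigenspaces are
  orthogonal and a vector orthogonal to all of them vanishes. Since \<open>U(t)\<^sup>* = U(-t)\<close>, every
  eigenvector \<open>u\<close> for \<open>\<theta>\<close> satisfies \<open>\<langle>u, U(t) v\<rangle> = e\<^bsup>t\<theta>\<^esup> \<langle>u, v\<rangle>\<close>. Hence \<open>U(\<tau>) e\<^sub>a = z e\<^sub>b\<close> gives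
  \<open>e\<^bsup>\<tau>\<theta>\<^esup> E\<^sub>\<theta> e\<^sub>a = z E\<^sub>\<theta> e\<^sub>b\<close>, and \<open>z = \<plusminus>1\<close> because \<open>U(\<tau>)\<close> is a real matrix; the two signs are
  the two parities. Conversely, the parity condition makes \<open>U(\<tau>) e\<^sub>a\<close> and \<open>z e\<^sub>b\<close> agree on the
  eigenspaces in the support of \<open>a\<close>. The difference \<open>w\<close> is orthogonal to these eigenspaces, hence
  to \<open>U(\<tau>) e\<^sub>a\<close>, and as both vectors have norm 1, Pythagoras forces \<open>w = 0\<close>. The time in the
  parity condition is the negative of the transfer time.\<close>

section \<open>Rules of computation for the Hermitian form\<close>

lemma hinner_add_right: "hinner u (v + w) = hinner u v + hinner u w"
  by (simp add: hinner_def distrib_left sum.distrib)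

lemma hinner_diff_right: "hinner u (v - w) = hinner u v - hinner u w"
  by (simp add: hinner_def right_diff_distrib sum_subtractf)

lemma hinner_scale_right: "hinner u (c *s v) = c * hinner u v"
  by (simp add: hinner_def sum_distrib_left mult.left_commute)

lemma hinner_scaleR_right: "hinner u (c *\<^sub>R v) = c *\<^sub>R hinner u v"
  by (simp add: hinner_def scaleR_sum_right)

lemma hinner_scaleR_left: "hinner (c *\<^sub>R u) v = c *\<^sub>R hinner u v"
  by (simp add: hinner_def scaleR_sum_right)

lemma hinner_zero_right [simp]: "hinner u 0 = 0"
  by (simp add: hinner_def)

lemma hinner_minus_right: "hinner u (- v) = - hinner u v"
  by (simp add: hinner_def sum_negf)

lemma cnj_hinner: "cnj (hinner u v) = hinner v u"
  by (simp add: hinner_def mult.commute)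

lemma hinner_self_eq_0_iff: "hinner u u = 0 \<longleftrightarrow> u = 0"
  by (metis Re_hinner hinner_zero_right inner_eq_zero_iff zero_complex.sel(1))

lemma matrix_vector_mult_scaleR:
  fixes M :: "complex^'n^'m"
  shows "(c *\<^sub>R M) *v x = c *\<^sub>R (M *v x)"
  by (simp add: matrix_vector_mult_def vec_eq_iff scaleR_sum_right)

section \<open>Eigenvectors of symmetric operators\<close>

text \<open>Rayleigh's argument: the form \<open>x \<bullet> H x\<close> attains its maximum on the
  compact unit sphere of \<open>S\<close>, and a maximiser is an eigenvector.\<close>

lemma exists_eigenvector_in_invariant_subspace:
  fixes H :: "'a::euclidean_space \<Rightarrow> 'a"
  assumes "linear H" and sym: "\<And>x y. H x \<bullet> y = x \<bullet> H y"
    and "subspace S" and inv: "\<And>x. x \<in> S \<Longrightarrow> H x \<in> S"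
    and "p \<in> S" "p \<noteq> 0"
  shows "\<exists>u\<in>S. u \<noteq> 0 \<and> (\<exists>l. H u = l *\<^sub>R u)"
proof -
  interpret H: linear H by fact
  let ?K = "S \<inter> sphere 0 1"
  have "compact ?K"
    using closed_subspace[OF \<open>subspace S\<close>] by (simp add: closed_Int_compact)
  moreover have "(1 / norm p) *\<^sub>R p \<in> ?K"
    using assms by (auto simp: subspace_scale)
  moreover have "continuous_on ?K (\<lambda>x. x \<bullet> H x)"
    using \<open>linear H\<close> by (intro continuous_intros linear_continuous_on)
      (auto simp: linear_conv_bounded_linear)
  ultimately obtain u where u: "u \<in> ?K" and max: "\<And>y. y \<in> ?K \<Longrightarrow> y \<bullet> H y \<le> u \<bullet> H u"
    using continuous_attains_sup[of ?K "\<lambda>x. x \<bullet> H x"] by blast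
  define l where "l = u \<bullet> H u"
  have uu: "u \<bullet> u = 1"
    using u by (simp add: norm_eq_1)
  \<comment> \<open>Both sides are homogeneous of degree 2, so the maximum on the sphere bounds the
    form on all of \<open>S\<close>.\<close>
  have pos: "y \<bullet> H y \<le> l * (y \<bullet> y)" if "y \<in> S" for y
  proof (cases "y = 0")
    case False
    have "(1 / norm y) *\<^sub>R y \<in> ?K"
      using False that \<open>subspace S\<close> by (auto simp: subspace_scale)
    from max[OF this] have "(y \<bullet> H y) / (norm y)\<^sup>2 \<le> l"
      by (simp add: l_def H.scaleR power2_eq_square)
    then show ?thesis
      using False by (simp add: divide_le_eq power2_norm_eq_inner mult.commute)
  qed simp
  \<comment> \<open>Perturbing \<open>u\<close> along its residual \<open>w\<close> yields the
    first-order term \<open>2 * t * (w \<bullet> w)\<close>; \<open>c\<close> collects the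
    second-order terms.\<close>
  define w where "w = H u - l *\<^sub>R u"
  have wS: "w \<in> S"
    using u inv \<open>subspace S\<close> by (auto simp: w_def subspace_diff subspace_scale)
  define c where "c = l * (w \<bullet> w) - w \<bullet> H w"
  have main: "2 * t * (w \<bullet> w) \<le> t\<^sup>2 * c" for t
  proof -
    have "u + t *\<^sub>R w \<in> S"
      using u wS \<open>subspace S\<close> by (auto simp: subspace_add subspace_scale)
    from pos[OF this] have "2 * t * (w \<bullet> H u - l * (w \<bullet> u)) \<le> t\<^sup>2 * c"
      using sym[of u w] uu l_def
      by (simp add: H.add H.scaleR algebra_simps inner_commute power2_eq_square c_def)
    then show ?thesis
      by (simp add: w_def inner_diff_right)
  qed
  have "w \<bullet> w = 0"
  proof (rule ccontr)
    assume "w \<bullet> w \<noteq> 0"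
    then have ww: "w \<bullet> w > 0"
      using inner_ge_zero[of w] by linarith
    have c: "c > 0"
      using main[of 1] ww by (simp del: inner_gt_zero_iff)
    \<comment> \<open>For s = \<open>w \<bullet> w\<close> and t = s / c, \<open>main\<close> reads
      2 s^2 / c \<le> s^2 / c, impossible for positive s and c.\<close>
    show False
      using main[of "(w \<bullet> w) / c"] ww c
      by (simp add: power2_eq_square field_simps del: inner_gt_zero_iff)
  qed
  then have "H u = l *\<^sub>R u"
    by (simp add: w_def)
  moreover have "u \<noteq> 0"
    using uu by auto
  ultimately show ?thesis
    using u by blast
qed

section \<open>Skew-Hermitian matrices and their eigenspaces\<close>

text \<open>Phrased through the form instead of the entries, because it serves to move
  \<open>A\<close> across \<open>hinner\<close>.\<close>

definition skew_hermitian :: "complex^'n^'n \<Rightarrow> bool" where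
  "skew_hermitian A \<longleftrightarrow> (\<forall>u v. hinner (A *v u) v = - hinner u (A *v v))"

lemma skew_hermitian_adj_matrix:
  assumes "oriented_graph X"
  shows "skew_hermitian (adj_matrix X)"
  unfolding skew_hermitian_def
proof (intro allI)
  fix u v :: "complex^'a"
  let ?A = "adj_matrix X"
  \<comment> \<open>The entries are real, and excluding loops and opposite arcs makes the nested
    conditional antisymmetric.\<close>
  have skew: "cnj (?A $ i $ j) = - (?A $ j $ i)" for i j
    using assms by (auto simp: adj_matrix_def oriented_graph_def)
  have "hinner (?A *v u) v = (\<Sum>i\<in>UNIV. \<Sum>j\<in>UNIV. - (cnj (u $ j) * (?A $ j $ i * v $ i)))"
    by (simp add: hinner_def matrix_vector_mult_def sum_distrib_right skew mult_ac
        sum_distrib_left)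
  also have "\<dots> = - hinner u (?A *v v)"
    by (subst sum.swap) (simp add: hinner_def matrix_vector_mult_def sum_distrib_left sum_negf)
  finally show "hinner (?A *v u) v = - hinner u (?A *v v)" .
qed

lemma skew_hermitian_scaleR: "skew_hermitian A \<Longrightarrow> skew_hermitian (t *\<^sub>R A)"
  by (simp add: skew_hermitian_def matrix_vector_mult_scaleR hinner_scaleR_left
      hinner_scaleR_right)

lemma skew_hermitian_eigenvalue:
  assumes "skew_hermitian A" "u \<in> eigenspace A \<theta>" "u \<noteq> 0"
  shows "cnj \<theta> = - \<theta>"
proof -
  have "cnj \<theta> * hinner u u = - \<theta> * hinner u u"
    using assms(1,2)
    by (metis (mono_tags, lifting) eigenspace_def hinner_scale_left hinner_scale_right
        mem_Collect_eq mult_minus_left skew_hermitian_def)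
  then have "cnj \<theta> = - \<theta> \<or> hinner u u = 0"
    by (metis mult_cancel_right)
  then show ?thesis
    using \<open>u \<noteq> 0\<close> by (simp add: hinner_self_eq_0_iff)
qed

lemma skew_hermitian_eigenspaces_orthogonal:
  assumes A: "skew_hermitian A" and u: "u \<in> eigenspace A \<theta>" and v: "v \<in> eigenspace A \<mu>"
    and "\<theta> \<noteq> \<mu>"
  shows "hinner u v = 0"
proof (cases "u = 0")
  case True
  then show ?thesis by (simp add: hinner_def)
next
  case False
  have "cnj \<theta> * hinner u v = - (\<mu> * hinner u v)"
    using A u v by (metis (mono_tags, lifting) eigenspace_def hinner_scale_left
        hinner_scale_right mem_Collect_eq skew_hermitian_def)
  then show ?thesis
    using skew_hermitian_eigenvalue[OF A u False] \<open>\<theta> \<noteq> \<mu>\<close> by simp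
qed

text \<open>\<open>\<Phi>\<close> may contain any complex numbers: a non-eigenvalue has eigenspace 0
  and imposes no condition. So \<open>UNIV\<close> and complements can be used without listing the
  spectrum.\<close>

definition eig_perp :: "complex^'n^'n \<Rightarrow> complex set \<Rightarrow> (complex^'n) set" where
  "eig_perp A \<Phi> = {v. \<forall>\<theta>\<in>\<Phi>. \<forall>u\<in>eigenspace A \<theta>. hinner u v = 0}"

lemma subspace_eig_perp: "subspace (eig_perp A \<Phi>)"
  by (rule subspaceI) (auto simp: eig_perp_def hinner_add_right hinner_scaleR_right)

lemma eig_perp_scale: "v \<in> eig_perp A \<Phi> \<Longrightarrow> c *s v \<in> eig_perp A \<Phi>"
  by (simp add: eig_perp_def hinner_scale_right)

text \<open>Skewness moves \<open>A\<close> onto the eigenvector, where it acts as a scalar.\<close>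

lemma eig_perp_mult:
  assumes "skew_hermitian A" "v \<in> eig_perp A \<Phi>"
  shows "A *v v \<in> eig_perp A \<Phi>"
proof -
  have "hinner u (A *v v) = 0" if "\<theta> \<in> \<Phi>" "u \<in> eigenspace A \<theta>" for u \<theta>
  proof -
    have "hinner (A *v u) v = 0"
      using that assms(2) by (simp add: eig_perp_def eigenspace_def hinner_scale_left)
    then show ?thesis
      using assms(1) by (simp add: skew_hermitian_def)
  qed
  then show ?thesis
    by (simp add: eig_perp_def)
qed

text \<open>The matrix \<open>\<i>A\<close> is Hermitian, hence symmetric for the real inner product on
  \<open>complex^'n\<close>, and so has an eigenvector in any nonzero invariant subspace.\<close>

lemma eig_perp_UNIV:
  assumes A: "skew_hermitian A" and p: "p \<in> eig_perp A UNIV"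
  shows "p = 0"
proof (rule ccontr)
  assume "p \<noteq> 0"
  define H where "H = (\<lambda>v. \<i> *s (A *v v))"
  have "linear H"
    by (rule linearI) (simp_all add: H_def vec_eq_iff matrix_vector_mult_def scaleR_sum_right
        distrib_left sum.distrib flip: scaleR_sum_right)
  moreover have "H x \<bullet> y = x \<bullet> H y" for x y
    using A by (simp add: H_def skew_hermitian_def hinner_scale_left hinner_scale_right
        flip: Re_hinner)
  moreover have "H x \<in> eig_perp A UNIV" if "x \<in> eig_perp A UNIV" for x
    using that A by (simp add: H_def eig_perp_mult eig_perp_scale)
  ultimately obtain u l where u: "u \<in> eig_perp A UNIV" "u \<noteq> 0" and l: "H u = l *\<^sub>R u"
    using exists_eigenvector_in_invariant_subspace[of H "eig_perp A UNIV" p]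
      subspace_eig_perp p \<open>p \<noteq> 0\<close> by blast
  \<comment> \<open>The eigenvector of \<open>H\<close> is also one of \<open>A\<close>, so it is
    orthogonal to itself.\<close>
  have "A *v u = (- \<i>) *s H u"
    by (simp add: H_def vec_eq_iff flip: mult.assoc)
  also have "\<dots> = (- \<i> * of_real l) *s u"
    by (simp add: l vec_eq_iff) (simp add: scaleR_conv_of_real)
  finally have "u \<in> eigenspace A (- \<i> * of_real l)"
    by (simp add: eigenspace_def)
  then have "hinner u u = 0"
    using u by (simp add: eig_perp_def)
  then show False
    using u by (simp add: hinner_self_eq_0_iff)
qed

text \<open>The projection \<open>p\<close> of \<open>y\<close> onto
  \<open>eig_perp A \<Phi>\<close> is orthogonal to eigenvectors for \<open>\<Phi>\<close> by
  membership. The other eigenvectors lie in that subspace, hence are orthogonal to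
  \<open>y - p\<close>, and also to \<open>y\<close>. So \<open>p = 0\<close> by
  completeness.\<close>

lemma hinner_eig_perp_compl:
  assumes A: "skew_hermitian A" and y: "y \<in> eig_perp A (- \<Phi>)" and w: "w \<in> eig_perp A \<Phi>"
  shows "hinner w y = 0"
proof -
  obtain p where p: "p \<in> eig_perp A \<Phi>" "\<And>u. u \<in> eig_perp A \<Phi> \<Longrightarrow> hinner u (y - p) = 0"
    using orth_proj_ex1[OF subspace_eig_perp[of A \<Phi>] eig_perp_scale, of y] by blast
  have "hinner u p = 0" if u: "u \<in> eigenspace A \<theta>" for u \<theta>
  proof (cases "\<theta> \<in> \<Phi>")
    case True
    then show ?thesis using p(1) u by (auto simp: eig_perp_def)
  next
    case False
    have "u \<in> eig_perp A \<Phi>"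
      unfolding eig_perp_def
      using skew_hermitian_eigenspaces_orthogonal[OF A _ u] False by blast
    from p(2)[OF this] show ?thesis
      using y u False by (auto simp: eig_perp_def hinner_diff_right)
  qed
  then have "p = 0"
    using eig_perp_UNIV[OF A] by (simp add: eig_perp_def)
  then show ?thesis
    using p(2)[OF w] by simp
qed

section \<open>The exponential of a skew-Hermitian matrix\<close>

lemma matrix_exp_mult_sums:
  fixes A :: "complex^'n^'n"
  shows "(\<lambda>k. (1 / fact k) *\<^sub>R (matrix_pow A k *v v)) sums (matrix_exp A *v v)"
proof -
  have "linear (\<lambda>M::complex^'n^'n. M *v v)"
    by (rule linearI) (simp_all add: matrix_vector_mult_scaleR matrix_vector_mult_add_rdistrib)
  then have "bounded_linear (\<lambda>M::complex^'n^'n. M *v v)"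
    by (simp add: linear_conv_bounded_linear)
  from bounded_linear.sums[OF this summable_sums[OF summable_matrix_exp[of A]]]
  show ?thesis
    by (simp add: matrix_exp_def matrix_vector_mult_scaleR)
qed

lemma bounded_linear_hinner_right: "bounded_linear (hinner u)"
  by (simp add: linearI hinner_add_right hinner_scaleR_right flip: linear_conv_bounded_linear)

lemma hinner_matrix_exp_sums:
  "(\<lambda>k. (1 / fact k) *\<^sub>R hinner u (matrix_pow A k *v v)) sums hinner u (matrix_exp A *v v)"
  using bounded_linear.sums[OF bounded_linear_hinner_right matrix_exp_mult_sums]
  by (simp add: hinner_scaleR_right)

lemma matrix_pow_0_mult: "matrix_pow A 0 *v v = v"
  by (simp add: matrix_pow_def)

lemma matrix_pow_Suc_mult: "matrix_pow A (Suc k) *v v = A *v (matrix_pow A k *v v)"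
  by (simp add: matrix_pow_def matrix_vector_mul_assoc)

lemma matrix_pow_Suc_mult': "matrix_pow A (Suc k) *v v = matrix_pow A k *v (A *v v)"
  by (induction k) (simp_all add: matrix_pow_Suc_mult matrix_pow_0_mult)

lemma hinner_matrix_pow_right:
  assumes "u \<in> eigenspace A \<theta>" and A: "skew_hermitian A"
  shows "hinner u (matrix_pow A k *v v) = (- cnj \<theta>) ^ k * hinner u v"
proof (induction k)
  case (Suc k)
  have "hinner u (matrix_pow A (Suc k) *v v) = - hinner (A *v u) (matrix_pow A k *v v)"
    using A by (simp add: matrix_pow_Suc_mult skew_hermitian_def)
  then show ?case
    using Suc assms(1) by (simp add: eigenspace_def hinner_scale_left)
qed (simp add: matrix_pow_0_mult)

text \<open>Term by term, each factor \<open>A\<close> contributes \<open>- cnj \<theta>\<close>,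
  which is \<theta> for an eigenvalue. If \<open>u = 0\<close>, \<theta> is arbitrary, hence the
  case split.\<close>

lemma hinner_matrix_exp_right:
  assumes u: "u \<in> eigenspace A \<theta>" and A: "skew_hermitian A"
  shows "hinner u (matrix_exp A *v v) = exp \<theta> * hinner u v"
proof (cases "u = 0")
  case True
  then show ?thesis by (simp add: hinner_def)
next
  case False
  have "(\<lambda>k. \<theta> ^ k /\<^sub>R fact k * hinner u v) sums (exp \<theta> * hinner u v)"
    by (intro sums_mult2 exp_converges)
  moreover have "(1 / fact k) *\<^sub>R hinner u (matrix_pow A k *v v) = \<theta> ^ k /\<^sub>R fact k * hinner u v"
    for k
    using skew_hermitian_eigenvalue[OF A u False]
    by (simp add: hinner_matrix_pow_right[OF u A] divide_inverse)
  ultimately have "(\<lambda>k. (1 / fact k) *\<^sub>R hinner u (matrix_pow A k *v v)) sums (exp \<theta> * hinner u v)"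
    by (simp only:)
  then show ?thesis
    by (rule sums_unique2[OF hinner_matrix_exp_sums])
qed

text \<open>Each factor changes sides at the cost of a sign. The outermost factor on the left
  becomes the innermost on the right, so \<open>v\<close> must vary in the induction.\<close>

lemma hinner_matrix_pow_left:
  assumes A: "skew_hermitian A"
  shows "hinner (matrix_pow A k *v u) v = hinner u (matrix_pow (- 1 *\<^sub>R A) k *v v)"
proof (induction k arbitrary: u v)
  case (Suc k)
  have "hinner (matrix_pow A (Suc k) *v u) v = hinner (matrix_pow A k *v u) ((- 1 *\<^sub>R A) *v v)"
    using A by (simp only: matrix_pow_Suc_mult matrix_vector_mult_scaleR skew_hermitian_def)
      (simp add: hinner_minus_right)
  then show ?case
    using Suc by (simp add: matrix_pow_Suc_mult')
qed (simp add: matrix_pow_0_mult)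

lemma hinner_matrix_exp_left:
  assumes A: "skew_hermitian A"
  shows "hinner (matrix_exp A *v u) v = hinner u (matrix_exp (- 1 *\<^sub>R A) *v v)"
proof -
  \<comment> \<open>The series expands the right argument of \<open>hinner\<close>; conjugation
    transfers it to the left.\<close>
  have "(\<lambda>k. cnj ((1 / fact k) *\<^sub>R hinner v (matrix_pow A k *v u)))
      sums cnj (hinner v (matrix_exp A *v u))"
    by (simp only: sums_cnj hinner_matrix_exp_sums)
  then have "(\<lambda>k. (1 / fact k) *\<^sub>R hinner u (matrix_pow (- 1 *\<^sub>R A) k *v v))
      sums hinner (matrix_exp A *v u) v"
    by (simp only: complex_cnj_scaleR cnj_hinner hinner_matrix_pow_left[OF A])
  then show ?thesis
    by (rule sums_unique2[OF _ hinner_matrix_exp_sums])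
qed

lemma eigenspace_scaleR: "u \<in> eigenspace A \<theta> \<Longrightarrow> u \<in> eigenspace (t *\<^sub>R A) (of_real t * \<theta>)"
  by (simp add: eigenspace_def matrix_vector_mult_scaleR vec_eq_iff)
    (simp add: scaleR_conv_of_real)

text \<open>Both sides have the same inner product with every eigenvector, which spares us
  multiplying the two power series.\<close>

lemma matrix_exp_uminus_mult:
  assumes A: "skew_hermitian A"
  shows "matrix_exp (- 1 *\<^sub>R A) *v (matrix_exp A *v v) = v"
proof -
  have "hinner u (matrix_exp (- 1 *\<^sub>R A) *v (matrix_exp A *v v) - v) = 0"
    if "u \<in> eigenspace A \<theta>" for u \<theta>
    using hinner_matrix_exp_right[OF eigenspace_scaleR[OF that, of "-1"] skew_hermitian_scaleR[OF A]]
      hinner_matrix_exp_right[OF that A]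
    by (simp add: hinner_diff_right flip: mult.assoc exp_add)
  then have "matrix_exp (- 1 *\<^sub>R A) *v (matrix_exp A *v v) - v = 0"
    by (intro eig_perp_UNIV[OF A]) (simp add: eig_perp_def)
  then show ?thesis by simp
qed

text \<open>The exponential of \<open>- A\<close> is both adjoint and left inverse to that of
  \<open>A\<close>.\<close>

lemma norm_matrix_exp_mult:
  assumes "skew_hermitian A"
  shows "norm (matrix_exp A *v v) = norm v"
proof -
  let ?y = "matrix_exp A *v v"
  have "hinner ?y ?y = hinner v (matrix_exp (- 1 *\<^sub>R A) *v ?y)"
    by (rule hinner_matrix_exp_left[OF assms])
  also have "\<dots> = hinner v v"
    by (subst matrix_exp_uminus_mult[OF assms]) (rule refl)
  finally have "?y \<bullet> ?y = v \<bullet> v"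
    by (subst (1 2) Re_hinner[symmetric]) (rule arg_cong[of _ _ Re])
  then show ?thesis
    by (simp only: norm_eq)
qed

lemma matrix_exp_real:
  fixes A :: "complex^'n^'n"
  assumes A: "\<And>i j. A $ i $ j \<in> \<real>" and v: "\<And>i. v $ i \<in> \<real>"
  shows "(matrix_exp A *v v) $ i \<in> \<real>"
proof -
  have pow: "(matrix_pow A k *v v) $ i \<in> \<real>" for k i
  proof (induction k arbitrary: i)
    case 0
    then show ?case by (simp add: matrix_pow_0_mult v)
  next
    case (Suc k)
    then show ?case
      unfolding matrix_pow_Suc_mult
      by (subst matrix_vector_mult_def) (simp add: A sum_in_Reals)
  qed
  \<comment> \<open>Coordinates and imaginary parts are bounded linear, so they pass through the
    series, whose terms are real.\<close>
  have "(\<lambda>k. Im (((1 / fact k) *\<^sub>R (matrix_pow A k *v v)) $ i)) sums Im ((matrix_exp A *v v) $ i)"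
    by (intro bounded_linear.sums[OF bounded_linear_Im]
        bounded_linear.sums[OF bounded_linear_vec_nth] matrix_exp_mult_sums)
  then have "Im ((matrix_exp A *v v) $ i) = 0"
    using pow by (simp add: complex_is_Real_iff sums_iff)
  then show ?thesis
    by (simp add: complex_is_Real_iff)
qed

section \<open>The transition matrix and the spectral projections\<close>

lemma transition_matrix_real: "(transition_matrix X t *v axis a 1) $ i \<in> \<real>"
  unfolding transition_matrix_def
  by (rule matrix_exp_real) (auto simp: adj_matrix_def axis_def complex_is_Real_iff)

lemma hinner_transition_matrix:
  assumes "oriented_graph X" "u \<in> eigenspace (adj_matrix X) \<theta>"
  shows "hinner u (transition_matrix X t *v v) = exp (of_real t * \<theta>) * hinner u v"
  unfolding transition_matrix_def
  using assms by (intro hinner_matrix_exp_right eigenspace_scaleR skew_hermitian_scaleR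
      skew_hermitian_adj_matrix)

lemma norm_transition_matrix:
  "oriented_graph X \<Longrightarrow> norm (transition_matrix X t *v v) = norm v"
  unfolding transition_matrix_def
  by (intro norm_matrix_exp_mult skew_hermitian_scaleR skew_hermitian_adj_matrix)

text \<open>Reduces equations between projections to inner products with eigenvectors. The
  difference of the two sides lies in the eigenspace, so testing it against itself suffices.\<close>

lemma eig_proj_eq_scale_iff:
  "eig_proj X \<theta> v = c *s eig_proj X \<theta> w \<longleftrightarrow>
     (\<forall>u\<in>eigenspace (adj_matrix X) \<theta>. hinner u v = c * hinner u w)"
proof -
  let ?S = "eigenspace (adj_matrix X) \<theta>" and ?d = "eig_proj X \<theta> v - c *s eig_proj X \<theta> w"
  have proj: "hinner u (eig_proj X \<theta> y) = hinner u y" if "u \<in> ?S" for u y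
    using eig_proj_props(2)[OF that, of y] by (simp add: hinner_diff_right)
  then have d: "hinner u ?d = hinner u v - c * hinner u w" if "u \<in> ?S" for u
    using that by (simp add: hinner_diff_right hinner_scale_right)
  have "?d \<in> ?S"
    by (intro subspace_diff subspace_eigenspace eigenspace_scale eig_proj_props(1))
  then have "?d = 0 \<longleftrightarrow> (\<forall>u\<in>?S. hinner u ?d = 0)"
    by (metis hinner_self_eq_0_iff hinner_zero_right)
  then show ?thesis
    using d by simp
qed

lemma not_in_eig_support:
  assumes "\<theta> \<notin> eig_support X a" "u \<in> eigenspace (adj_matrix X) \<theta>"
  shows "hinner u (axis a 1) = 0"
proof (cases "u = 0")
  case True
  then show ?thesis by (simp add: hinner_def)
next
  case False
  \<comment> \<open>The nonzero \<open>u\<close> makes \<theta> an eigenvalue, so absence from the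
    support means a vanishing projection; the factor 0 fits the preceding criterion.\<close>
  then have "eig_proj X \<theta> (axis a 1) = 0 *s eig_proj X \<theta> (axis a 1)"
    using assms by (auto simp: eig_support_def is_eigenvalue_def)
  then show ?thesis
    using assms(2) unfolding eig_proj_eq_scale_iff by simp
qed

section \<open>Parity as a value of the exponential\<close>

lemma exp_eq_one_iff_even: "exp (\<i> * of_real pi * x) = 1 \<longleftrightarrow> (\<exists>k::int. even k \<and> x = of_int k)"
proof -
  have "exp (\<i> * of_real pi * x) = exp 0 \<longleftrightarrow> (\<exists>n::int. x = of_int (2 * n))"
    unfolding exp_eq by simp
  then show ?thesis
    unfolding exp_zero by (metis dvd_def)
qed

lemma exp_eq_minus_one_iff_odd:
  "exp (\<i> * of_real pi * x) = - 1 \<longleftrightarrow> (\<exists>k::int. odd k \<and> x = of_int k)"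
proof -
  have "exp (\<i> * of_real pi * x) = exp (\<i> * of_real pi) \<longleftrightarrow> (\<exists>n::int. x = of_int (2 * n + 1))"
  proof -
    have "\<i> * of_real pi * x = \<i> * of_real pi + of_int (2 * n) * of_real pi * \<i> \<longleftrightarrow>
        (\<i> * of_real pi) * x = (\<i> * of_real pi) * of_int (2 * n + 1)" for n
      by (simp add: algebra_simps)
    then show ?thesis
      unfolding exp_eq by simp
  qed
  moreover have "exp (\<i> * of_real pi) = (- 1 :: complex)"
    by (metis exp_pi_i')
  moreover have "odd k \<longleftrightarrow> (\<exists>n. k = 2 * n + 1)" for k :: int
    by (auto elim: oddE)
  ultimately show ?thesis
    by auto
qed

section \<open>Perfect state transfer and quarrels\<close>

lemma norm_axis:
  fixes x :: "'a::real_inner"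
  shows "norm (axis i x :: 'a^'n) = norm x"
  by (simp only: norm_eq_sqrt_inner[of "axis i x"] norm_eq_sqrt_inner[of x] inner_axis_axis simp_thms
      if_True)

lemma strongly_cospectral_transfer:
  assumes X: "oriented_graph X" and sc: "\<And>\<theta>. \<theta> \<in> eig_support X a \<Longrightarrow>
      eig_proj X \<theta> (axis a 1) = (z * exp (- (of_real t * \<theta>))) *s eig_proj X \<theta> (axis b 1)"
    and z: "norm z = 1"
  shows "transition_matrix X t *v axis a 1 = z *s axis b 1"
proof -
  let ?A = "adj_matrix X" and ?y = "transition_matrix X t *v axis a 1"
  let ?w = "z *s axis b 1 - ?y"
  \<comment> \<open>The transition matrix only scales inner products with eigenvectors, so
    orthogonality of \<open>axis a 1\<close> to an eigenspace persists.\<close>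
  have "?y \<in> eig_perp ?A (- eig_support X a)"
    by (simp add: eig_perp_def hinner_transition_matrix[OF X] not_in_eig_support)
  moreover have "?w \<in> eig_perp ?A (eig_support X a)"
    unfolding eig_perp_def
  proof safe
    fix \<theta> u assume \<theta>: "\<theta> \<in> eig_support X a" and u: "u \<in> eigenspace ?A \<theta>"
    have "hinner u (axis a 1) = z * exp (- (of_real t * \<theta>)) * hinner u (axis b 1)"
      using sc[OF \<theta>] u unfolding eig_proj_eq_scale_iff by blast
    then show "hinner u ?w = 0"
      by (simp add: hinner_diff_right hinner_scale_right hinner_transition_matrix[OF X u]
          exp_minus)
  qed
  ultimately have "hinner ?w ?y = 0"
    using hinner_eig_perp_compl skew_hermitian_adj_matrix[OF X] by blast
  then have "?w \<bullet> ?y = 0"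
    by (simp flip: Re_hinner)
  \<comment> \<open>The sum \<open>?w + ?y\<close> is \<open>z *s axis b 1\<close>, of norm 1 like
    \<open>?y\<close>, which leaves norm 0 for \<open>?w\<close>.\<close>
  then have "(norm (?w + ?y))\<^sup>2 = (norm ?w)\<^sup>2 + (norm ?y)\<^sup>2"
    by (intro norm_add_Pythagorean) (simp add: orthogonal_def)
  moreover have "norm ?y = 1"
    by (simp only: norm_transition_matrix[OF X] norm_axis norm_one)
  moreover have "norm (z *s (axis b 1 :: complex^'a)) = 1"
  proof -
    have "z *s (axis b 1 :: complex^'a) = axis b z"
      by (simp add: vec_eq_iff axis_def)
    then show ?thesis by (simp only: z norm_axis)
  qed
  ultimately show ?thesis by simp
qed

text \<open>\<open>q\<close> is any admissible choice of quarrels, so the equivalence covers both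
  values at phase -1. Quarrels are defined only under strong cospectrality, hence the conditional
  assumption.\<close>

theorem theorem5p3:
  fixes X :: "('v::finite \<times> 'v) set" and a b :: 'v and q :: "complex \<Rightarrow> real"
  assumes "oriented_graph X"
    and "strongly_cospectral X a b \<Longrightarrow> \<forall>\<theta>\<in>eig_support X a. is_quarrel X a b \<theta> (q \<theta>)"
  shows "perfect_state_transfer X a b \<longleftrightarrow>
    strongly_cospectral X a b \<and>
    (\<exists>\<tau>::real.
      (\<forall>\<theta>\<in>eig_support X a. \<exists>k::int. even k \<and>
         complex_of_real (q \<theta>) + \<i> * complex_of_real \<tau> * \<theta> / complex_of_real pi = of_int k) \<or>
      (\<forall>\<theta>\<in>eig_support X a. \<exists>k::int. odd k \<and>
         complex_of_real (q \<theta>) + \<i> * complex_of_real \<tau> * \<theta> / complex_of_real pi = of_int k))"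
proof -
  let ?x = "\<lambda>\<tau> \<theta>. complex_of_real (q \<theta>) + \<i> * complex_of_real \<tau> * \<theta> / complex_of_real pi"
  have phase: "exp (\<i> * of_real pi * ?x \<tau> \<theta>) = exp (\<i> * of_real (pi * q \<theta>)) * exp (- (of_real \<tau> * \<theta>))"
    for \<tau> \<theta>
  proof -
    have "\<i> * of_real pi * ?x \<tau> \<theta> = \<i> * of_real (pi * q \<theta>) + - (of_real \<tau> * \<theta>)"
      by (simp add: field_simps)
    then show ?thesis by (simp only: exp_add)
  qed
  have quarrel: "eig_proj X \<theta> (axis a 1) =
      exp (\<i> * of_real (pi * q \<theta>)) *s eig_proj X \<theta> (axis b 1)"
    if "strongly_cospectral X a b" "\<theta> \<in> eig_support X a" for \<theta>
    using assms(2) that by (auto simp: is_quarrel_def)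
  show ?thesis
    \<comment> \<open>Both parity conditions now say that one exponential is constant on the
      support, equal to 1 or to -1.\<close>
    unfolding exp_eq_one_iff_even[symmetric] exp_eq_minus_one_iff_odd[symmetric]
  proof (intro iffI conjI)
    assume "perfect_state_transfer X a b"
    then obtain t z where z: "norm z = 1"
      and t: "transition_matrix X t *v axis a 1 = z *s axis b 1"
      by (auto simp: perfect_state_transfer_def)
    have proj: "eig_proj X \<theta> (axis a 1) =
        (z * exp (- (of_real t * \<theta>))) *s eig_proj X \<theta> (axis b 1)" for \<theta>
      unfolding eig_proj_eq_scale_iff
    proof
      fix u assume "u \<in> eigenspace (adj_matrix X) \<theta>"
      from hinner_transition_matrix[OF assms(1) this, of t "axis a 1"]
      show "hinner u (axis a 1) = z * exp (- (of_real t * \<theta>)) * hinner u (axis b 1)"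
        by (simp add: t hinner_scale_right exp_minus field_simps)
    qed
    have imaginary: "Re \<theta> = 0" if "\<theta> \<in> eig_support X a" for \<theta>
    proof -
      from that have "cnj \<theta> = - \<theta>"
        using skew_hermitian_eigenvalue[OF skew_hermitian_adj_matrix[OF assms(1)]]
        by (auto simp: eig_support_def is_eigenvalue_def)
      then show ?thesis by (simp add: complex_eq_iff)
    qed
    show sc: "strongly_cospectral X a b"
      unfolding strongly_cospectral_def
    proof
      fix \<theta> assume "\<theta> \<in> eig_support X a"
      then have "norm (z * exp (- (of_real t * \<theta>))) = 1"
        by (simp add: norm_mult z imaginary)
      then show "\<exists>\<alpha>. norm \<alpha> = 1 \<and> eig_proj X \<theta> (axis a 1) = \<alpha> *s eig_proj X \<theta> (axis b 1)"
        using proj by blast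
    qed
    \<comment> \<open>\<open>z\<close> is the entry at \<open>b\<close> of a real vector.\<close>
    have "z \<in> \<real>"
      using transition_matrix_real[of X t a b] by (simp add: t)
    with z have "z = 1 \<or> z = - 1"
      by (metis Reals_cases abs_eq_iff' norm_of_real of_real_1 of_real_minus)
    \<comment> \<open>At time \<open>- t\<close>, \<open>phase\<close> supplies the factor
      exp(t\<theta>) that cancels the one in \<open>proj\<close>.\<close>
    moreover have "exp (\<i> * of_real pi * ?x (- t) \<theta>) = z" if \<theta>: "\<theta> \<in> eig_support X a" for \<theta>
    proof -
      let ?e = "exp (\<i> * of_real (pi * q \<theta>))"
      have "?e *s eig_proj X \<theta> (axis b 1) = (z * exp (- (of_real t * \<theta>))) *s eig_proj X \<theta> (axis b 1)"
        using quarrel[OF sc \<theta>] proj by metis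
      \<comment> \<open>Needed to cancel the vector and compare scalars.\<close>
      moreover have "eig_proj X \<theta> (axis b 1) \<noteq> 0"
        using quarrel[OF sc \<theta>] \<theta> by (auto simp: eig_support_def)
      ultimately have "?e = z * exp (- (of_real t * \<theta>))"
        by simp
      then show ?thesis
        unfolding phase by (simp add: exp_minus)
    qed
    ultimately show "\<exists>\<tau>. (\<forall>\<theta>\<in>eig_support X a. exp (\<i> * of_real pi * ?x \<tau> \<theta>) = 1) \<or>
        (\<forall>\<theta>\<in>eig_support X a. exp (\<i> * of_real pi * ?x \<tau> \<theta>) = - 1)"
      by blast
  next
    assume *: "strongly_cospectral X a b \<and>
      (\<exists>\<tau>. (\<forall>\<theta>\<in>eig_support X a. exp (\<i> * of_real pi * ?x \<tau> \<theta>) = 1) \<or>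
        (\<forall>\<theta>\<in>eig_support X a. exp (\<i> * of_real pi * ?x \<tau> \<theta>) = - 1))"
    \<comment> \<open>One \<open>z\<close> handles both parities: 1 for even, -1 for odd.\<close>
    then obtain \<tau> and z :: complex where z: "norm z = 1"
      and \<tau>: "\<And>\<theta>. \<theta> \<in> eig_support X a \<Longrightarrow> exp (\<i> * of_real pi * ?x \<tau> \<theta>) = z"
      by (metis norm_minus_cancel norm_one)
    have "eig_proj X \<theta> (axis a 1) =
        (z * exp (- (of_real (- \<tau>) * \<theta>))) *s eig_proj X \<theta> (axis b 1)"
      if \<theta>: "\<theta> \<in> eig_support X a" for \<theta>
    proof -
      have "exp (\<i> * of_real (pi * q \<theta>)) = z * exp (- (of_real (- \<tau>) * \<theta>))"
        using \<tau>[OF \<theta>] unfolding phase by (auto simp: exp_minus)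
      then show ?thesis
        using quarrel \<theta> * by metis
    qed
    from strongly_cospectral_transfer[OF assms(1) this z]
    show "perfect_state_transfer X a b"
      using z by (auto simp: perfect_state_transfer_def)
  qed
qed

end
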